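(* Let $\alpha > -1$ and $n \in \mathbb{N}$ with $n\ge 3$ be such that the Laguerre polynomials $L_n^{(\alpha+4)}(x)$ and $L_n^{(\alpha)}(x)$ have no common zeros. Let $w_1>0$ be the smallest zero of $L_n^{(\alpha+4)}(x)$, and let $p_3$ be the cubic polynomial $$p_3(x) = (x+\alpha+3)(x+\alpha+2)(x+\alpha+1) - x(x+\alpha+1)(\alpha+n+3) - x(x+\alpha+3)(\alpha+n+2).$$ Suppose that $p_3$ has one real zero $l_1$ with $l_1 < w_1$, and that the remaining two zeros of $p_3$ (counted with multiplicity) are either negative or have non-zero imaginary part. Then the zeros of $L_n^{(\alpha+4)}(x)$ and $L_n^{(\alpha)}(x)$ are interlacing.
   Context: $\mathbb{N}=\{1,2,3,\dots\}$. For $\alpha>-1$ and an integer $n\ge 0$, $L_n^{(\alpha)}(x)=\sum_{k=0}^{n}\binom{n+\alpha}{n-k}\frac{(-x)^k}{k!}$ is the Laguerre polynomial of degree $n$; the sequence $\{L_n^{(\alpha)}\}_{n\ge 0}$ is orthogonal on $(0,\infty)$ with respect to the weight $e^{-x}x^{\alpha}$, and $L_n^{(\alpha)}$ has $n$ real, simple, positive zeros. The zeros of two polynomials $p,q$ of equal degree, each having only real simple zeros, are said to be interlacing if each open interval with endpoints at a pair of consecutive zeros of $p$ contains exactly one zero of $q$, and conversely. *)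

theory Defs
  imports
    "HOL-Computational_Algebra.Computational_Algebra"
    Complex_Main
begin

definition laguerre :: "nat \<Rightarrow> real \<Rightarrow> real poly" where
  "laguerre n \<alpha> =
     (\<Sum>k\<le>n. monom (((real n + \<alpha>) gchoose (n - k)) * (-1) ^ k / fact k) k)"

definition p3 :: "nat \<Rightarrow> real \<Rightarrow> real poly" where
  "p3 n \<alpha> =
     [:\<alpha> + 3, 1:] * [:\<alpha> + 2, 1:] * [:\<alpha> + 1, 1:]
     - [:0, 1:] * [:\<alpha> + 1, 1:] * [:\<alpha> + real n + 3:]
     - [:0, 1:] * [:\<alpha> + 3, 1:] * [:\<alpha> + real n + 2:]"

text \<open>\<^const>\<open>rsquarefree\<close> says that no root has order above 1; it is stated for the complex
  polynomial, so that all complex roots are covered.\<close>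

definition only_real_simple_zeros :: "real poly \<Rightarrow> bool" where
  "only_real_simple_zeros p \<longleftrightarrow>
     rsquarefree (map_poly complex_of_real p) \<and>
     (\<forall>z. poly (map_poly complex_of_real p) z = 0 \<longrightarrow> z \<in> \<real>)"

definition consecutive_zeros :: "real poly \<Rightarrow> real \<Rightarrow> real \<Rightarrow> bool" where
  "consecutive_zeros p a b \<longleftrightarrow>
     a < b \<and> poly p a = 0 \<and> poly p b = 0 \<and> (\<forall>x. a < x \<and> x < b \<longrightarrow> poly p x \<noteq> 0)"

text \<open>Equal degrees and real simple zeros are built into the notion: without them the
  conditions on consecutive zeros could hold vacuously.\<close>

definition interlacing :: "real poly \<Rightarrow> real poly \<Rightarrow> bool" where
  "interlacing p q \<longleftrightarrow>
     degree p = degree q \<and> only_real_simple_zeros p \<and> only_real_simple_zeros q \<and>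
     (\<forall>a b. consecutive_zeros p a b \<longrightarrow> (\<exists>!x. a < x \<and> x < b \<and> poly q x = 0)) \<and>
     (\<forall>a b. consecutive_zeros q a b \<longrightarrow> (\<exists>!x. a < x \<and> x < b \<and> poly p x = 0))"

end

theory Submission
  imports Defs
begin

text \<open>
  Write \<open>u\<^sub>k = L\<^sub>n\<^sup>(\<^sup>\<alpha>\<^sup>+\<^sup>k\<^sup>)\<close>. Since \<open>u\<^sub>k\<^sub>+\<^sub>1 = u\<^sub>k - u\<^sub>k'\<close>, Laguerre's differential equation yields
  \<open>x u\<^sub>k\<^sub>+\<^sub>2 = (x + \<alpha> + k + 1) u\<^sub>k\<^sub>+\<^sub>1 - (n + \<alpha> + k + 1) u\<^sub>k\<close>, and iterating this expresses \<open>x\<^sup>3 u\<^sub>4\<close> as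
  \<open>p\<^sub>3 u\<^sub>1\<close> plus a multiple of \<open>u\<^sub>0\<close>. The hypothesis on the zeros forces \<open>l\<^sub>1 < 0\<close> because
  \<open>p\<^sub>3(0) > 0\<close>, so \<open>p\<^sub>3 > 0\<close> on \<open>(0, \<infinity>)\<close> and \<open>u\<^sub>4\<close> has the sign of \<open>u\<^sub>1 = -u\<^sub>0'\<close> at every zero of
  \<open>u\<^sub>0\<close>. This sign alternates along the zeros of \<open>u\<^sub>0\<close>; as the leading coefficients agree, \<open>u\<^sub>4\<close> also
  has a zero beyond the last zero of \<open>u\<^sub>0\<close>, and counting zeros gives interlacing. The same principle,
  applied to \<open>x y'\<close> and \<open>y\<close> for \<open>y = L\<^sub>n\<^sup>(\<^sup>\<alpha>\<^sup>)\<close>, shows by induction on \<open>n\<close> that \<open>y\<close> has \<open>n\<close> positive zeros.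
\<close>

section \<open>Sign patterns at simple zeros\<close>

text \<open>Right after \<open>a\<close>, \<open>p\<close> has the sign of its derivative there; the
  opposite sign at \<open>c\<close> would force a zero in between.\<close>

lemma poly_sign_right:
  fixes p :: "real poly"
  assumes "poly p a = 0" "poly (pderiv p) a \<noteq> 0" "a < c"
    and nz: "\<And>x. a < x \<Longrightarrow> x \<le> c \<Longrightarrow> poly p x \<noteq> 0"
  shows "poly p c * poly (pderiv p) a > 0"
proof -
  have pos: "poly q c > 0"
    if q: "poly q a = 0" "poly (pderiv q) a > 0" "\<And>x. a < x \<Longrightarrow> x \<le> c \<Longrightarrow> poly q x \<noteq> 0"
    for q :: "real poly"
  proof (rule ccontr)
    assume "\<not> ?thesis"
    with q(3)[of c] \<open>a < c\<close> have neg: "poly q c < 0" by fastforce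
    obtain d where "d > 0" and d: "\<And>h. h > 0 \<Longrightarrow> h < d \<Longrightarrow> poly q (a + h) > 0"
      using DERIV_pos_inc_right[OF poly_DERIV q(2)] q(1) by auto
    define e where "e = a + min (d / 2) ((c - a) / 2)"
    have "poly q e > 0"
      unfolding e_def by (rule d) (use \<open>d > 0\<close> \<open>a < c\<close> in auto)
    moreover have "a < e" "e < c"
      using \<open>d > 0\<close> \<open>a < c\<close> by (auto simp: e_def min_def field_simps)
    ultimately show False using poly_IVT_neg[of e c q] neg q(3) by fastforce
  qed
  show ?thesis
  proof (cases "poly (pderiv p) a > 0")
    case True
    then show ?thesis using pos[of p] assms by simp
  next
    case False
    then show ?thesis using pos[of "-p"] assms by (simp add: pderiv_minus mult_neg_neg)
  qed
qed

text \<open>Reflecting x to -x reduces this to the right-hand case and flips the sign of the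
  derivative.\<close>

lemma poly_sign_left:
  fixes p :: "real poly"
  assumes "poly p a = 0" "poly (pderiv p) a \<noteq> 0" "c < a"
    and nz: "\<And>x. c \<le> x \<Longrightarrow> x < a \<Longrightarrow> poly p x \<noteq> 0"
  shows "poly p c * poly (pderiv p) a < 0"
proof -
  define q where "q = pcompose p [:0, -1:]"
  have "poly q (-c) * poly (pderiv q) (-a) > 0"
    using assms by (intro poly_sign_right) (auto simp: q_def poly_pcompose pderiv_pcompose pderiv_pCons)
  then show ?thesis
    by (simp add: q_def poly_pcompose pderiv_pcompose pderiv_pCons)
qed

lemma poly_sign_at_top:
  fixes p :: "real poly"
  assumes "p \<noteq> 0"
  shows "\<exists>N. \<forall>x\<ge>N. poly p x * lead_coeff p > 0"
proof (cases "lead_coeff p > 0")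
  case True
  then obtain N where "\<forall>x\<ge>N. poly p x \<ge> lead_coeff p" using poly_pinfty_gt_lc by blast
  with True show ?thesis by (meson less_le_trans mult_pos_pos)
next
  case False
  with assms have "lead_coeff (-p) > 0"
    by (metis lead_coeff_minus leading_coeff_0_iff neg_0_less_iff_less linorder_neqE_linordered_idom)
  then obtain N where N: "\<forall>x\<ge>N. poly (-p) x \<ge> lead_coeff (-p)" using poly_pinfty_gt_lc by blast
  have "poly p x * lead_coeff p > 0" if "x \<ge> N" for x
    using N that \<open>lead_coeff (-p) > 0\<close> by (intro mult_neg_neg) auto
  then show ?thesis by blast
qed

text \<open>The derivative of \<open>p\<close> changes sign between consecutive zeros of
  \<open>p\<close>, hence by \<open>alt\<close> so does \<open>q\<close>. After the last zero
  \<open>a\<close>, \<open>p\<close> keeps the sign of its derivative at \<open>a\<close>; so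
  \<open>q\<close> starts with the sign opposite to the eventual one, which by \<open>lead\<close>
  both polynomials share.\<close>

lemma next_zero_exists:
  fixes p q :: "real poly"
  assumes lead: "lead_coeff p * lead_coeff q > 0"
    and alt: "\<And>a. poly p a = 0 \<Longrightarrow> poly q a * poly (pderiv p) a < 0"
    and a: "poly p a = 0"
  shows "\<exists>b>a. poly q b = 0 \<and> (\<forall>x. a < x \<and> x \<le> b \<longrightarrow> poly p x \<noteq> 0)"
proof -
  have "p \<noteq> 0" "q \<noteq> 0" using lead by auto
  then have fin: "finite {x. poly p x = 0}" using poly_roots_finite by blast
  have simple: "poly (pderiv p) x \<noteq> 0" if "poly p x = 0" for x
    using alt[OF that] by auto
  show ?thesis
  proof (cases "\<exists>x>a. poly p x = 0")
    case True
    define B where "B = {x. a < x \<and> poly p x = 0}"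
    have B: "finite B" "B \<noteq> {}" using fin True by (auto simp: B_def)
    define b where "b = Min B"
    have "b \<in> B" using B by (simp add: b_def)
    then have b: "a < b" "poly p b = 0" by (auto simp: B_def)
    have nz: "poly p x \<noteq> 0" if "a < x" "x < b" for x
      using that B Min_le[of B x] by (auto simp: b_def B_def)
    obtain m where m: "a < m" "m < b" using b dense by blast
    have "poly p m * poly (pderiv p) a > 0" "poly p m * poly (pderiv p) b < 0"
      using m a b nz by (auto intro!: poly_sign_right poly_sign_left simple)
    with alt[OF a] alt[OF b(2)] have "poly q a * poly q b < 0"
      by (auto simp: mult_less_0_iff zero_less_mult_iff)
    then obtain z where "a < z" "z < b" "poly q z = 0"
      using poly_IVT[OF b(1)] by blast
    with nz show ?thesis by force
  next
    case False
    obtain M N where "\<forall>x\<ge>M. poly p x * lead_coeff p > 0" "\<forall>x\<ge>N. poly q x * lead_coeff q > 0"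
      using poly_sign_at_top \<open>p \<noteq> 0\<close> \<open>q \<noteq> 0\<close> by meson
    then obtain c where c: "a < c" "poly p c * lead_coeff p > 0" "poly q c * lead_coeff q > 0"
      by (meson gt_ex less_imp_le max.strict_boundedE)
    have "poly p c * poly (pderiv p) a > 0"
      using a c(1) False by (intro poly_sign_right simple) auto
    with c lead alt[OF a] have "poly q a * poly q c < 0"
      by (auto simp: mult_less_0_iff zero_less_mult_iff)
    then obtain z where "a < z" "z < c" "poly q z = 0"
      using poly_IVT[OF c(1)] by blast
    with False show ?thesis by auto
  qed
qed

section \<open>Interlacing\<close>

text \<open>Choosing for each zero of \<open>p\<close> the zero of \<open>q\<close> given by
  \<open>next_zero_exists\<close> is injective, and \<open>q\<close> has at most
  \<open>degree p\<close> zeros, so the choice is onto.\<close>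

lemma zeros_bij_betw:
  fixes p q :: "real poly"
  assumes deg: "degree q = degree p"
    and card: "card {x. poly p x = 0} = degree p"
    and lead: "lead_coeff p * lead_coeff q > 0"
    and alt: "\<And>a. poly p a = 0 \<Longrightarrow> poly q a * poly (pderiv p) a < 0"
  shows "\<exists>f. bij_betw f {x. poly p x = 0} {x. poly q x = 0} \<and>
    (\<forall>a. poly p a = 0 \<longrightarrow> a < f a \<and> (\<forall>x. a < x \<and> x \<le> f a \<longrightarrow> poly p x \<noteq> 0))"
proof -
  let ?P = "{x. poly p x = 0}" and ?Q = "{x. poly q x = 0}"
  have "q \<noteq> 0" using lead by auto
  obtain f where f: "\<And>a. poly p a = 0 \<Longrightarrow> a < f a \<and> poly q (f a) = 0 \<and>
      (\<forall>x. a < x \<and> x \<le> f a \<longrightarrow> poly p x \<noteq> 0)"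
    using next_zero_exists[OF lead alt] by metis
  have "inj_on f ?P"
  proof (rule linorder_inj_onI)
    \<comment> \<open>No zero of \<open>p\<close> lies after \<open>a\<close> up to
      \<open>f a\<close>, so f a < b < f b.\<close>
    show "f a \<noteq> f b" if "a < b" "a \<in> ?P" "b \<in> ?P" for a b
      using f[of a] f[of b] that by force
  qed auto
  moreover have "f ` ?P = ?Q"
  proof (rule card_seteq)
    show "finite ?Q" using \<open>q \<noteq> 0\<close> by (rule poly_roots_finite)
    show "f ` ?P \<subseteq> ?Q" using f by auto
    show "card ?Q \<le> card (f ` ?P)"
      using card_poly_roots_bound[OF \<open>q \<noteq> 0\<close>] card_image[OF \<open>inj_on f ?P\<close>] deg card by simp
  qed
  ultimately show ?thesis using f unfolding bij_betw_def by blast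
qed

text \<open>At a multiple zero one linear factor could be removed without losing a zero, leaving too
  many zeros for the smaller degree. The general coefficient ring covers both real and complex
  polynomials.\<close>

lemma simple_zero_if_card_zeros_eq_degree:
  fixes p :: "'a::{idom} poly"
  assumes "p \<noteq> 0" "card {x. poly p x = 0} = degree p" "poly p a = 0"
  shows "poly (pderiv p) a \<noteq> 0"
proof
  assume d: "poly (pderiv p) a = 0"
  from assms obtain r where r: "p = [:-a, 1:] * r" by (auto simp: poly_eq_0_iff_dvd)
  with \<open>p \<noteq> 0\<close> have "r \<noteq> 0" by auto
  from d have "poly r a = 0" unfolding r by (subst (asm) pderiv_mult) (simp add: pderiv_pCons)
  then have "{x. poly p x = 0} = {x. poly r x = 0}" by (auto simp: r)
  with card_poly_roots_bound[OF \<open>r \<noteq> 0\<close>] assms(2) have "degree p \<le> degree r" by simp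
  moreover have "degree p = Suc (degree r)"
    unfolding r using \<open>r \<noteq> 0\<close> by (subst degree_mult_eq) auto
  ultimately show False by simp
qed

lemma poly_map_poly_of_real:
  "poly (map_poly complex_of_real p) (of_real x) = of_real (poly p x)"
  by (induction p) (auto simp: map_poly_pCons)

text \<open>The real zeros already exhaust the degree of the complexified polynomial, so it has no
  others and none is multiple.\<close>

lemma only_real_simple_zerosI:
  assumes "p \<noteq> 0" "card {x. poly p x = 0} = degree p"
  shows "only_real_simple_zeros p"
proof -
  let ?c = "map_poly complex_of_real p"
  have deg: "degree ?c = degree p" by (simp add: degree_map_poly)
  have nz: "?c \<noteq> 0" using assms(1) by (simp add: map_poly_eq_0_iff)
  have sub: "of_real ` {x. poly p x = 0} \<subseteq> {z. poly ?c z = 0}"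
    by (auto simp: poly_map_poly_of_real)
  have card: "card (complex_of_real ` {x. poly p x = 0}) = degree ?c"
    using assms(2) deg by (subst card_image) (auto simp: inj_on_def)
  have eq: "of_real ` {x. poly p x = 0} = {z. poly ?c z = 0}"
    using card_seteq[OF poly_roots_finite[OF nz] sub] card card_poly_roots_bound[OF nz] by simp
  then have "rsquarefree ?c"
    using simple_zero_if_card_zeros_eq_degree[OF nz] card by (auto simp: rsquarefree_roots)
  moreover have "z \<in> \<real>" if "poly ?c z = 0" for z
    using that eq by (auto simp: Reals_def)
  ultimately show ?thesis by (simp add: only_real_simple_zeros_def)
qed

text \<open>With \<open>f\<close> from \<open>zeros_bij_betw\<close>, the zeros come in the order a1
  < f a1 < a2 < f a2 < ..., where the ai are the zeros of \<open>p\<close>.\<close>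

lemma interlacing_if_alternating:
  assumes deg: "degree q = degree p"
    and card: "card {x. poly p x = 0} = degree p"
    and lead: "lead_coeff p * lead_coeff q > 0"
    and alt: "\<And>a. poly p a = 0 \<Longrightarrow> poly q a * poly (pderiv p) a < 0"
  shows "interlacing q p"
proof -
  obtain f where bij: "bij_betw f {x. poly p x = 0} {x. poly q x = 0}"
    and above: "\<And>a. poly p a = 0 \<Longrightarrow> a < f a"
    and first: "\<And>a x. poly p a = 0 \<Longrightarrow> a < x \<Longrightarrow> x \<le> f a \<Longrightarrow> poly p x \<noteq> 0"
    using zeros_bij_betw[OF assms] by blast
  have zero: "poly q (f a) = 0" if "poly p a = 0" for a
    using bij that by (auto simp: bij_betw_def)
  have preimage: "\<exists>a. poly p a = 0 \<and> y = f a" if "poly q y = 0" for y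
    using bij that by (auto simp: bij_betw_def)
  have less: "f a < b" if "poly p a = 0" "poly p b = 0" "a < b" for a b
    using first[of a b] that by fastforce
  have pq: "\<exists>!x. a < x \<and> x < b \<and> poly q x = 0" if "consecutive_zeros p a b" for a b
  proof (rule ex1I[of _ "f a"])
    from that have ab: "a < b" "poly p a = 0" "poly p b = 0"
      "\<And>x. a < x \<Longrightarrow> x < b \<Longrightarrow> poly p x \<noteq> 0" by (auto simp: consecutive_zeros_def)
    then show "a < f a \<and> f a < b \<and> poly q (f a) = 0" using above zero less by blast
    fix y assume y: "a < y \<and> y < b \<and> poly q y = 0"
    then obtain c where c: "poly p c = 0" "y = f c" using preimage by blast
    with above[of c] y have "c < b" by simp
    with ab(4)[of c] c have "c \<le> a" by fastforce
    with less[of c a] c y ab show "y = f a" by fastforce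
  qed
  have qp: "\<exists>!x. c < x \<and> x < d \<and> poly p x = 0" if "consecutive_zeros q c d" for c d
  proof -
    from that have cd: "c < d" "poly q c = 0" "poly q d = 0"
      "\<And>x. c < x \<Longrightarrow> x < d \<Longrightarrow> poly q x \<noteq> 0" by (auto simp: consecutive_zeros_def)
    obtain a b where a: "poly p a = 0" "c = f a" and b: "poly p b = 0" "d = f b"
      using preimage cd by meson
    have "a < b"
      using less[of b a] above[of a] a b cd(1) by (cases a b rule: linorder_cases) auto
    show ?thesis
    proof (rule ex1I[of _ b])
      show "c < b \<and> b < d \<and> poly p b = 0" using a b less above \<open>a < b\<close> by blast
      fix x assume x: "c < x \<and> x < d \<and> poly p x = 0"
      \<comment> \<open>If x < b, the zero \<open>f x\<close> of \<open>q\<close> would lie strictly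
        between \<open>c\<close> and \<open>d\<close>.\<close>
      have "\<not> x < b" using less[of x b] above[of x] above[of b] cd(4)[of "f x"] zero[of x] x b by auto
      moreover have "\<not> b < x" using first[of b x] b x by auto
      ultimately show "x = b" by simp
    qed
  qed
  have "card {x. poly q x = 0} = degree q"
    using bij_betw_same_card[OF bij] card deg by simp
  moreover have "p \<noteq> 0" "q \<noteq> 0" using lead by auto
  ultimately show ?thesis
    using only_real_simple_zerosI card deg pq qp by (simp add: interlacing_def)
qed

section \<open>Laguerre polynomials\<close>

lemma coeff_laguerre:
  "coeff (laguerre n \<alpha>) k =
     (if k \<le> n then ((real n + \<alpha>) gchoose (n - k)) * (-1) ^ k / fact k else 0)"
  by (simp add: laguerre_def coeff_sum)

text \<open>This is Laguerre's differential equation read off at the coefficient of x^k.\<close>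

lemma coeff_laguerre_Suc:
  "real (Suc k) * (real k + \<alpha> + 1) * coeff (laguerre n \<alpha>) (Suc k) =
     - (real n - real k) * coeff (laguerre n \<alpha>) k"
proof (cases "k < n")
  case True
  then obtain m where m: "n - k = Suc m" by (metis Suc_diff_Suc)
  have nm: "real n = real k + real m + 1" using m True by linarith
  \<comment> \<open>Absorption identity: n + \<alpha> - m equals k + \<alpha> + 1, and m + 1 equals
    n - k.\<close>
  have "(real n + \<alpha>) * ((real n + \<alpha>) gchoose m) =
      real m * ((real n + \<alpha>) gchoose m) + real (Suc m) * ((real n + \<alpha>) gchoose Suc m)"
    by (rule gbinomial_mult_1)
  then have g: "(real k + \<alpha> + 1) * ((real n + \<alpha>) gchoose m) =
      (real n - real k) * ((real n + \<alpha>) gchoose Suc m)"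
    by (simp add: nm algebra_simps)
  have "n - Suc k = m" using m by simp
  then have "real (Suc k) * (real k + \<alpha> + 1) * coeff (laguerre n \<alpha>) (Suc k) =
      - (((real k + \<alpha> + 1) * ((real n + \<alpha>) gchoose m)) * (-1) ^ k / fact k)"
    using True by (simp add: coeff_laguerre divide_simps)
  also have "\<dots> = - (real n - real k) * coeff (laguerre n \<alpha>) k"
    using True m unfolding g by (simp add: coeff_laguerre algebra_simps diff_divide_distrib)
  finally show ?thesis .
qed (auto simp: coeff_laguerre)

lemma degree_laguerre: "degree (laguerre n \<alpha>) = n"
  by (rule antisym) (auto intro!: degree_le le_degree simp: coeff_laguerre)

lemma lead_coeff_laguerre: "lead_coeff (laguerre n \<alpha>) = (-1) ^ n / fact n"
  by (simp add: degree_laguerre coeff_laguerre)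

lemma laguerre_nonzero: "laguerre n \<alpha> \<noteq> 0"
  using lead_coeff_laguerre[of n \<alpha>] by auto

lemma pderiv_laguerre_Suc: "pderiv (laguerre (Suc n) \<alpha>) = - laguerre n (\<alpha> + 1)"
  by (rule poly_eqI) (auto simp: coeff_pderiv coeff_laguerre divide_simps add_ac)

text \<open>Pascal's rule, coefficient by coefficient.\<close>

lemma laguerre_plus_1: "laguerre n (\<alpha> + 1) = laguerre n \<alpha> - pderiv (laguerre n \<alpha>)"
proof (rule poly_eqI)
  fix k
  show "coeff (laguerre n (\<alpha> + 1)) k = coeff (laguerre n \<alpha> - pderiv (laguerre n \<alpha>)) k"
  proof (cases "k < n")
    case True
    then obtain m where m: "n - k = Suc m" "n - Suc k = m" by (metis Suc_diff_Suc)
    have "(real n + (\<alpha> + 1)) gchoose Suc m =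
        ((real n + \<alpha>) gchoose m) + ((real n + \<alpha>) gchoose Suc m)"
      using gbinomial_Suc_Suc[of "real n + \<alpha>" m] by (simp add: add_ac)
    then show ?thesis using True m
      by (simp add: coeff_pderiv coeff_laguerre divide_simps) (simp add: algebra_simps)
  qed (auto simp: coeff_pderiv coeff_laguerre)
qed

lemma laguerre_ode:
  "[:0, 1:] * pderiv (pderiv (laguerre n \<alpha>)) + [:\<alpha> + 1, -1:] * pderiv (laguerre n \<alpha>)
     + smult (real n) (laguerre n \<alpha>) = 0" (is "?l = 0")
proof (rule poly_eqI)
  fix k
  show "coeff ?l k = coeff 0 k"
    using coeff_laguerre_Suc[of k \<alpha> n]
    by (cases k) (auto simp: coeff_pderiv algebra_simps)
qed

lemma laguerre_ode_poly:
  "x * poly (pderiv (pderiv (laguerre n \<alpha>))) x + (\<alpha> + 1 - x) * poly (pderiv (laguerre n \<alpha>)) x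
     + real n * poly (laguerre n \<alpha>) x = 0"
  using arg_cong[OF laguerre_ode[of n \<alpha>], of "\<lambda>p. poly p x"] by (simp add: algebra_simps)

lemma poly_laguerre_plus_1:
  "poly (laguerre n (\<alpha> + 1)) x = poly (laguerre n \<alpha>) x - poly (pderiv (laguerre n \<alpha>)) x"
  by (simp add: laguerre_plus_1)

text \<open>Both shifted polynomials are combinations of the unshifted one and its first two
  derivatives; the differential equation eliminates the second derivative.\<close>

lemma laguerre_plus_2:
  "x * poly (laguerre n (\<alpha> + 2)) x =
     (x + \<alpha> + 1) * poly (laguerre n (\<alpha> + 1)) x - (real n + \<alpha> + 1) * poly (laguerre n \<alpha>) x"
proof -
  have "laguerre n (\<alpha> + 2) = laguerre n (\<alpha> + 1) - pderiv (laguerre n (\<alpha> + 1))"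
    using laguerre_plus_1[of n "\<alpha> + 1"] by (simp add: add.assoc)
  then have "poly (laguerre n (\<alpha> + 2)) x = poly (laguerre n \<alpha>) x
      - 2 * poly (pderiv (laguerre n \<alpha>)) x + poly (pderiv (pderiv (laguerre n \<alpha>))) x"
    by (simp add: laguerre_plus_1[of n \<alpha>] pderiv_diff)
  then show ?thesis
    using laguerre_ode_poly[of x n \<alpha>] unfolding poly_laguerre_plus_1 by algebra
qed

text \<open>Three instances of \<open>laguerre_plus_2\<close> with \<open>u 2\<close> and
  \<open>u 3\<close> eliminated; each instance contributes one factor x on the left.\<close>

lemma laguerre_plus_4:
  "x ^ 3 * poly (laguerre n (\<alpha> + 4)) x =
     poly (p3 n \<alpha>) x * poly (laguerre n (\<alpha> + 1)) x
     - (real n + \<alpha> + 1) * ((x + \<alpha> + 3) * (x + \<alpha> + 2) - x * (real n + \<alpha> + 3))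
       * poly (laguerre n \<alpha>) x"
proof -
  define u where "u k = poly (laguerre n (\<alpha> + real k)) x" for k
  have rec: "x * u (k + 2) = (x + \<alpha> + real k + 1) * u (k + 1) - (real n + \<alpha> + real k + 1) * u k" for k
    using laguerre_plus_2[of x n "\<alpha> + real k"] by (simp add: u_def add_ac)
  have r0: "x * u 2 = (x + \<alpha> + 1) * u 1 - (real n + \<alpha> + 1) * u 0"
    and r1: "x * u 3 = (x + \<alpha> + 2) * u 2 - (real n + \<alpha> + 2) * u 1"
    and r2: "x * u 4 = (x + \<alpha> + 3) * u 3 - (real n + \<alpha> + 3) * u 2"
    using rec[of 0] rec[of 1] rec[of 2] by (simp_all add: numeral_eq_Suc add_ac)
  have "x ^ 3 * u 4 = poly (p3 n \<alpha>) x * u 1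
     - (real n + \<alpha> + 1) * ((x + \<alpha> + 3) * (x + \<alpha> + 2) - x * (real n + \<alpha> + 3)) * u 0"
    using r0 r1 r2 unfolding p3_def by simp algebra
  then show ?thesis by (simp add: u_def)
qed

text \<open>The constant coefficient is a binomial coefficient whose numerator is the product of n +
  \<alpha> - i for i < n, each factor at least 1 + \<alpha>.\<close>

lemma laguerre_0_pos:
  assumes "\<alpha> > -1"
  shows "poly (laguerre n \<alpha>) 0 > 0"
  using assms by (auto simp: poly_0_coeff_0 coeff_laguerre gbinomial_prod_rev intro!: prod_pos divide_pos_pos)

lemma laguerre_positive_zeros:
  assumes "\<alpha> > -1"
  shows "card {x. poly (laguerre n \<alpha>) x = 0} = n \<and> (\<forall>x. poly (laguerre n \<alpha>) x = 0 \<longrightarrow> x > 0)"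
  using assms
proof (induction n arbitrary: \<alpha>)
  case 0
  have "laguerre 0 \<alpha> = 1" by (simp add: laguerre_def)
  then show ?case by simp
next
  case (Suc n)
  define y where "y = laguerre (Suc n) \<alpha>"
  define d where "d = laguerre n (\<alpha> + 1)"
  \<comment> \<open>This is x times the derivative of \<open>y\<close>. The factor x raises the
    degree to that of \<open>y\<close> and adds the zero 0, whose partner completes the count of n +
    1 zeros of \<open>y\<close>.\<close>
  define p where "p = [:0, -1:] * d"
  have dy: "pderiv y = -d" by (simp add: y_def d_def pderiv_laguerre_Suc)
  have IH: "card {x. poly d x = 0} = n" "\<And>x. poly d x = 0 \<Longrightarrow> x > 0"
    using Suc.IH[of "\<alpha> + 1"] Suc.prems by (auto simp: d_def)
  have d: "d \<noteq> 0" "degree d = n" "lead_coeff d = (-1) ^ n / fact n"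
    using laguerre_nonzero lead_coeff_laguerre by (auto simp: d_def degree_laguerre)
  have y: "degree y = Suc n" "lead_coeff y = (-1) ^ Suc n / fact (Suc n)"
    unfolding y_def by (simp only: degree_laguerre, rule lead_coeff_laguerre)
  have zeros: "{x. poly p x = 0} = insert 0 {x. poly d x = 0}" by (auto simp: p_def)
  have pd: "poly (pderiv p) x = - poly d x - x * poly (pderiv d) x" for x
    by (simp add: p_def pderiv_pCons pderiv_minus)
  have ode: "x * poly (pderiv d) x + (\<alpha> + 1 - x) * poly d x = real (Suc n) * poly y x" for x
    using laguerre_ode_poly[of x "Suc n" \<alpha>] dy by (simp add: y_def[symmetric] pderiv_minus)
  have deg: "degree y = degree p" using d y by (simp add: p_def)
  have card: "card {x. poly p x = 0} = degree p"
  proof -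
    have "finite {x. poly d x = 0}" using d by (intro poly_roots_finite)
    then show ?thesis
      using IH deg y unfolding zeros by (subst card_insert_disjoint) force+
  qed
  have "lead_coeff p = - lead_coeff d" using d by (simp add: p_def)
  then have lead: "lead_coeff p * lead_coeff y > 0"
    using d(3) y(2) by (simp add: zero_less_mult_iff zero_less_divide_iff flip: power_add)
  have alt: "poly y a * poly (pderiv p) a < 0" if "poly p a = 0" for a
  proof -
    from that consider "a = 0" | "poly d a = 0" by (auto simp: p_def)
    then show ?thesis
    proof cases
      case 1
      then show ?thesis using laguerre_0_pos[of \<alpha> "Suc n"] laguerre_0_pos[of "\<alpha> + 1" n] Suc.prems
        by (simp add: pd y_def d_def)
    next
      case 2
      then have "poly (pderiv d) a \<noteq> 0" "a > 0"
        using simple_zero_if_card_zeros_eq_degree[of d a] d IH by auto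
      \<comment> \<open>At a zero of \<open>d\<close> the differential equation reduces to this,
        while the derivative of \<open>p\<close> is -a d'(a), of opposite sign.\<close>
      moreover have "real (Suc n) * poly y a = a * poly (pderiv d) a" using ode[of a] 2 by simp
      then have "poly y a = a * poly (pderiv d) a / real (Suc n)" by (simp add: field_simps)
      ultimately show ?thesis using 2
        by (simp add: pd mult_less_0_iff zero_less_mult_iff zero_less_divide_iff divide_less_0_iff)
           linarith
    qed
  qed
  obtain f where f: "bij_betw f {x. poly p x = 0} {x. poly y x = 0}"
    "\<And>a. poly p a = 0 \<Longrightarrow> a < f a"
    using zeros_bij_betw[OF deg card lead alt] by blast
  have "card {x. poly y x = 0} = Suc n"
    using bij_betw_same_card[OF f(1)] IH d unfolding zeros
    by (subst (asm) card_insert_disjoint) (auto intro: poly_roots_finite)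
  moreover have "x > 0" if "poly y x = 0" for x
  proof -
    from f(1) that obtain a where "poly p a = 0" "x = f a" by (auto simp: bij_betw_def)
    moreover from this have "a \<ge> 0" using IH(2)[of a] by (auto simp: p_def)
    ultimately show ?thesis using f(2)[of a] by simp
  qed
  ultimately show ?case by (simp add: y_def)
qed

section \<open>Positivity of the cubic\<close>

text \<open>For t \<ge> 0 the factor (t - z2)(t - z3) is real and positive, so the cubic has the
  sign of t - l1 there; being positive at 0, it forces l1 < 0.\<close>

lemma p3_pos:
  fixes \<alpha> l1 :: real and z2 z3 :: complex
  assumes \<alpha>: "\<alpha> > -1"
    and fac: "map_poly complex_of_real (p3 n \<alpha>) =
           [:- complex_of_real l1, 1:] * [:- z2, 1:] * [:- z3, 1:]"
    and neg: "\<And>z. z \<in> {z2, z3} \<Longrightarrow> (z \<in> \<real> \<and> Re z < 0) \<or> Im z \<noteq> 0"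
    and "x > 0"
  shows "poly (p3 n \<alpha>) x > 0"
proof -
  have val: "complex_of_real (poly (p3 n \<alpha>) t) =
      complex_of_real (t - l1) * ((complex_of_real t - z2) * (complex_of_real t - z3))" for t
    using arg_cong[OF fac, of "\<lambda>p. poly p (complex_of_real t)"]
    by (simp add: poly_map_poly_of_real algebra_simps)
  \<comment> \<open>Real coefficients make z2 + z3 and z2 z3 real, so z2 and z3 are both real or
    conjugate.\<close>
  have c2: "complex_of_real (coeff (p3 n \<alpha>) 2) = - (of_real l1 + z2 + z3)"
    and c1: "complex_of_real (coeff (p3 n \<alpha>) 1) = of_real l1 * (z2 + z3) + z2 * z3"
    using arg_cong[OF fac, of "\<lambda>p. coeff p 2"] arg_cong[OF fac, of "\<lambda>p. coeff p 1"]
    by (simp_all add: coeff_map_poly numeral_2_eq_2 algebra_simps)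
  have im: "Im z3 = - Im z2" using arg_cong[OF c2, of Im] by simp
  have im': "Im z2 * (Re z3 - Re z2) = 0"
    using arg_cong[OF c1, of Im] im by (simp add: algebra_simps) argo
  have Q: "\<exists>r>0. (complex_of_real t - z2) * (complex_of_real t - z3) = complex_of_real r"
    if "t \<ge> 0" for t
  proof (cases "Im z2 = 0")
    case True
    then have "Re z2 < 0" "Re z3 < 0" using neg[of z2] neg[of z3] im by auto
    then show ?thesis using True im that
      by (intro exI[of _ "(t - Re z2) * (t - Re z3)"]) (simp add: complex_eq_iff)
  next
    case False
    then have "Re z3 = Re z2" using im' by simp
    \<comment> \<open>For a conjugate pair the product is the squared modulus of t - z2.\<close>
    then show ?thesis using False im
      by (intro exI[of _ "(t - Re z2)\<^sup>2 + (Im z2)\<^sup>2"])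
         (simp add: complex_eq_iff sum_power2_gt_zero_iff, simp add: power2_eq_square algebra_simps)
  qed
  have val_real: "\<exists>r>0. poly (p3 n \<alpha>) t = (t - l1) * r" if "t \<ge> 0" for t
    using Q[OF that] val[of t] by (metis of_real_eq_iff of_real_mult)
  have "poly (p3 n \<alpha>) 0 > 0" using \<alpha> by (simp add: p3_def)
  with val_real[of 0] have "l1 < 0" by (auto simp: mult_less_0_iff)
  with val_real[of x] \<open>x > 0\<close> show ?thesis by auto
qed

theorem theorem3p2:
  fixes \<alpha> w1 l1 :: real and n :: nat and z2 z3 :: complex
  assumes "\<alpha> > -1" and "n \<ge> 3"
    and "\<not> (\<exists>x. poly (laguerre n (\<alpha> + 4)) x = 0 \<and> poly (laguerre n \<alpha>) x = 0)"
    and "poly (laguerre n (\<alpha> + 4)) w1 = 0"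
    and "\<And>x. poly (laguerre n (\<alpha> + 4)) x = 0 \<Longrightarrow> w1 \<le> x"
    and "map_poly complex_of_real (p3 n \<alpha>) =
           [:- complex_of_real l1, 1:] * [:- z2, 1:] * [:- z3, 1:]"
    and "l1 < w1"
    and "\<And>z. z \<in> {z2, z3} \<Longrightarrow> (z \<in> \<real> \<and> Re z < 0) \<or> Im z \<noteq> 0"
  shows "interlacing (laguerre n (\<alpha> + 4)) (laguerre n \<alpha>)"
proof (rule interlacing_if_alternating)
  let ?y = "laguerre n \<alpha>" and ?u = "laguerre n (\<alpha> + 4)"
  show "degree ?u = degree ?y" by (simp add: degree_laguerre)
  show card: "card {x. poly ?y x = 0} = degree ?y"
    using laguerre_positive_zeros[OF assms(1)] by (simp add: degree_laguerre)
  show "lead_coeff ?y * lead_coeff ?u > 0"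
    unfolding lead_coeff_laguerre by (simp flip: power_add)
  fix a assume a: "poly ?y a = 0"
  then have "a > 0" using laguerre_positive_zeros[OF assms(1)] by blast
  have "poly (pderiv ?y) a \<noteq> 0"
    using simple_zero_if_card_zeros_eq_degree[OF laguerre_nonzero card a] .
  then have sq: "(poly (pderiv ?y) a)\<^sup>2 > 0" by simp
  \<comment> \<open>At a zero of \<open>?y\<close> the last term of \<open>laguerre_plus_4\<close>
    vanishes and the polynomial with parameter \<alpha> + 1 equals minus the derivative of
    \<open>?y\<close>.\<close>
  have "a ^ 3 * poly ?u a = - poly (p3 n \<alpha>) a * poly (pderiv ?y) a"
    using laguerre_plus_4[of a n \<alpha>] a by (simp add: poly_laguerre_plus_1)
  then have "a ^ 3 * (poly ?u a * poly (pderiv ?y) a) = - poly (p3 n \<alpha>) a * (poly (pderiv ?y) a)\<^sup>2"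
    unfolding power2_eq_square by algebra
  also have "\<dots> < 0" using p3_pos[OF assms(1,6,8) \<open>a > 0\<close>] sq by simp
  finally show "poly ?u a * poly (pderiv ?y) a < 0"
    using \<open>a > 0\<close> by (simp add: mult_less_0_iff)
qed

end
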